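(* Let $A$ be a real $2\times2$ constant matrix with distinct nonzero real eigenvalues $\lambda_1>\lambda_2$. Then $A$ has the form $$A=\begin{bmatrix} a & b\\ c&\lambda_1+\lambda_2-a\end{bmatrix}$$ with $a,b,c\in\mathbb{R}$, and the system $\boldsymbol{x}'(t)=A\boldsymbol{x}(t)$, $t\in\mathbb{R}$, is Hyers-Ulam stable on $\mathbb{R}$, with HUS constant $$K=\frac{|\lambda_2|\max\left\{|a-\lambda_2|+|b|,\ |c|+|\lambda_1-a|\right\}+|\lambda_1|\max\left\{|\lambda_1-a|+|b|,\ |c|+|a-\lambda_2|\right\}}{|\lambda_1\lambda_2|(\lambda_1-\lambda_2)}.$$
   Context: For $\boldsymbol{v}=(v_1,v_2)^T\in\mathbb{R}^2$, $\|\boldsymbol{v}\|_\infty=\max\{|v_1|,|v_2|\}$. The system $\boldsymbol{x}'=A\boldsymbol{x}$ is Hyers-Ulam stable on $\mathbb{R}$ with Hyers-Ulam stability (HUS) constant $K>0$ if for every $\varepsilon>0$ and every differentiable $\boldsymbol{\phi}:\mathbb{R}\to\mathbb{R}^2$ with $\|\boldsymbol{\phi}'(t)-A\boldsymbol{\phi}(t)\|_\infty\le\varepsilon$ for all $t\in\mathbb{R}$, there exists a solution $\boldsymbol{x}:\mathbb{R}\to\mathbb{R}^2$ of $\boldsymbol{x}'=A\boldsymbol{x}$ with $\|\boldsymbol{\phi}(t)-\boldsymbol{x}(t)\|_\infty\le K\varepsilon$ for all $t\in\mathbb{R}$. (The constant $K$ does not depend on $\varepsilon$ or $\boldsymbol{\phi}$.)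 *)

theory Defs
  imports "HOL-Analysis.Analysis"
begin

definition eigenvalue :: "real^'n^'n \<Rightarrow> real \<Rightarrow> bool" where
  "eigenvalue A l \<longleftrightarrow> (\<exists>v. v \<noteq> 0 \<and> A *v v = l *\<^sub>R v)"

definition solves_system :: "real^2^2 \<Rightarrow> (real \<Rightarrow> real^2) \<Rightarrow> bool" where
  "solves_system A x \<longleftrightarrow> (\<forall>t. (x has_vector_derivative A *v x t) (at t))"

text \<open>The norm used here is the maximum norm: on \<open>real^2\<close> the library's \<open>infnorm\<close>
  satisfies \<open>infnorm v = max \<bar>v $ 1\<bar> \<bar>v $ 2\<bar>\<close> (library fact \<open>infnorm_2\<close>).\<close>

definition hyers_ulam_stable_with_constant :: "real^2^2 \<Rightarrow> real \<Rightarrow> bool" where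
  "hyers_ulam_stable_with_constant A K \<longleftrightarrow>
     K > 0 \<and>
     (\<forall>\<epsilon>>0. \<forall>\<phi>::real \<Rightarrow> real^2.
        (\<forall>t. \<phi> differentiable (at t)) \<longrightarrow>
        (\<forall>t. infnorm (vector_derivative \<phi> (at t) - A *v \<phi> t) \<le> \<epsilon>) \<longrightarrow>
        (\<exists>x. solves_system A x \<and> (\<forall>t. infnorm (\<phi> t - x t) \<le> K * \<epsilon>)))"

end

theory Submission
  imports Defs
begin

text \<open>
  Write \<open>d = l1 - l2\<close>. Two distinct eigenvalues force the trace of \<open>A\<close> to be \<open>l1 + l2\<close>, which
  gives the form of \<open>A\<close>, and \<open>(A - l1)(A - l2) = 0\<close>. Hence \<open>P = (A - l2)/d\<close> and
  \<open>Q = (l1 - A)/d\<close> are the spectral projections: \<open>P + Q = 1\<close>, \<open>A P = P A = l1 P\<close> and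
  \<open>A Q = Q A = l2 Q\<close>.

  Let \<open>\<phi>\<close> be an approximate solution with defect \<open>f = \<phi>' - A \<phi>\<close>. Then \<open>P \<phi>\<close> satisfies
  \<open>(P \<phi>)' - l1 P \<phi> = P f\<close>, so each of its coordinates is an approximate solution of the scalar
  equation \<open>y' = l1 y\<close>, and scalar stability (\<open>scalar_hyers_ulam\<close>) yields a vector \<open>w\<close> such that
  \<open>P \<phi> t\<close> stays within \<open>\<parallel>P\<parallel> \<epsilon> / \<bar>l1\<bar>\<close> of \<open>exp (l1 t) w\<close>, where \<open>\<parallel>P\<parallel>\<close> is the operator norm for the
  maximum norm, i.e. the largest absolute row sum. Coordinatewise reasoning does not by itself put
  \<open>w\<close> into the eigenspace; it lies there because \<open>(A - l1) exp (l1 t) w\<close> is bounded in \<open>t\<close>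
  (\<open>spectral_component_stable\<close>). The same holds for \<open>Q\<close>, and adding the two exponentials
  gives an exact solution at distance at most \<open>(\<parallel>P\<parallel>/\<bar>l1\<bar> + \<parallel>Q\<parallel>/\<bar>l2\<bar>) \<epsilon>\<close> from \<open>\<phi>\<close>. The largest
  absolute row sums of \<open>P\<close> and \<open>Q\<close> are the two maxima in the constant, divided by \<open>d\<close>.
\<close>

section \<open>Stability of a scalar linear equation\<close>

text \<open>
  The integrating factor turns the hypothesis into \<open>\<bar>h'\<bar> \<le> \<delta> exp (- l t)\<close> for
  \<open>h t = exp (- l t) u t\<close>. So \<open>h t - (\<delta>/l) exp (- l t)\<close> increases, \<open>h t + (\<delta>/l) exp (- l t)\<close>
  decreases, and the former lies below the latter. Comparing them at the later of two times shows
  that every value of the first is at most every value of the second, and any number separating the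
  ranges of these two functions serves as \<open>C\<close>.
\<close>

lemma scalar_hyers_ulam_pos:
  fixes u u' :: "real \<Rightarrow> real"
  assumes l: "l > 0"
    and der: "\<And>t. (u has_real_derivative u' t) (at t)"
    and bound: "\<And>t. \<bar>u' t - l * u t\<bar> \<le> \<delta>"
  shows "\<exists>C. \<forall>t. \<bar>u t - exp (l * t) * C\<bar> \<le> \<delta> / l"
proof -
  define L where "L t = exp (- l * t) * (u t - \<delta> / l)" for t
  define U where "U t = exp (- l * t) * (u t + \<delta> / l)" for t
  have L_mono: "L s \<le> L t" if "s \<le> t" for s t
  proof (rule DERIV_nonneg_imp_nondecreasing[OF that])
    fix x
    have "(L has_real_derivative exp (- l * x) * (u' x - l * u x + \<delta>)) (at x)"
      unfolding L_def using l by (auto intro!: derivative_eq_intros der simp: field_simps)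
    moreover have "0 \<le> exp (- l * x) * (u' x - l * u x + \<delta>)"
      using bound[of x] by (intro mult_nonneg_nonneg) (auto simp: abs_le_iff)
    ultimately show "\<exists>y. (L has_real_derivative y) (at x) \<and> 0 \<le> y" by blast
  qed
  have U_mono: "U t \<le> U s" if "s \<le> t" for s t
  proof (rule DERIV_nonpos_imp_nonincreasing[OF that])
    fix x
    have "(U has_real_derivative exp (- l * x) * (u' x - l * u x - \<delta>)) (at x)"
      unfolding U_def using l by (auto intro!: derivative_eq_intros der simp: field_simps)
    moreover have "exp (- l * x) * (u' x - l * u x - \<delta>) \<le> 0"
      using bound[of x] by (intro mult_nonneg_nonpos) (auto simp: abs_le_iff)
    ultimately show "\<exists>y. (U has_real_derivative y) (at x) \<and> y \<le> 0" by blast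
  qed
  have "\<delta> \<ge> 0" using bound[of 0] by linarith
  then have "L t \<le> U t" for t
    using l unfolding L_def U_def by (intro mult_left_mono) (auto simp: field_simps)
  then have LU: "L s \<le> U t" for s t
    using L_mono[of s "max s t"] U_mono[of t "max s t"]
    by (meson max.cobounded1 max.cobounded2 order_trans)
  define C where "C = (SUP s. L s)"
  have "L t \<le> C" for t
    unfolding C_def using LU
    by (intro cSUP_upper bdd_aboveI2[where M = "U 0"]) auto
  moreover have "C \<le> U t" for t
    unfolding C_def using LU by (intro cSUP_least) auto
  ultimately have "exp (l * t) * L t \<le> exp (l * t) * C" "exp (l * t) * C \<le> exp (l * t) * U t" for t
    by simp_all
  then have "u t - \<delta> / l \<le> exp (l * t) * C" "exp (l * t) * C \<le> u t + \<delta> / l" for t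
    by (simp_all add: L_def U_def mult.assoc[symmetric] exp_minus_inverse flip: exp_add)
  then show ?thesis by (intro exI[of _ C]) (auto simp: abs_le_iff algebra_simps)
qed

text \<open>Reversing time maps \<open>l < 0\<close> to the case \<open>l > 0\<close>.\<close>

lemma scalar_hyers_ulam:
  fixes u u' :: "real \<Rightarrow> real"
  assumes l: "l \<noteq> 0"
    and der: "\<And>t. (u has_real_derivative u' t) (at t)"
    and bound: "\<And>t. \<bar>u' t - l * u t\<bar> \<le> \<delta>"
  shows "\<exists>C. \<forall>t. \<bar>u t - exp (l * t) * C\<bar> \<le> \<delta> / \<bar>l\<bar>"
proof (cases "l > 0")
  case True
  then show ?thesis using scalar_hyers_ulam_pos[OF True der bound] by simp
next
  case False
  with l have neg: "- l > 0" by simp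
  have "((\<lambda>t. u (- t)) has_real_derivative - u' (- t)) (at t)" for t
    using DERIV_chain2[where g = uminus, OF der DERIV_minus[OF DERIV_ident]] by simp
  moreover have "\<bar>- u' (- t) - (- l) * u (- t)\<bar> \<le> \<delta>" for t
    using bound[of "- t"] by (simp add: abs_minus_commute)
  ultimately obtain C where C: "\<And>t. \<bar>u (- t) - exp (- l * t) * C\<bar> \<le> \<delta> / - l"
    using scalar_hyers_ulam_pos[OF neg, of "\<lambda>t. u (- t)" "\<lambda>t. - u' (- t)" \<delta>] by blast
  have "\<bar>u t - exp (l * t) * C\<bar> \<le> \<delta> / \<bar>l\<bar>" for t
    using C[of "- t"] neg by simp
  then show ?thesis by blast
qed

section \<open>Stability of one spectral component\<close>

lemma infnorm_le_iff_cart: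
  fixes x :: "real^'n"
  shows "infnorm x \<le> r \<longleftrightarrow> (\<forall>i. \<bar>x $ i\<bar> \<le> r)"
  unfolding infnorm_Max by (auto simp: Basis_vec_def inner_axis)

text \<open>
  The vector \<open>w\<close> is found coordinate by coordinate. It is an eigenvector because the projected
  function takes values in the kernel of \<open>A - l\<close>: thus \<open>exp (l t) (A - l) w\<close> is the image of a
  bounded function of \<open>t\<close>, hence bounded, whereas \<open>exp (l t)\<close> is unbounded.
\<close>

lemma spectral_component_stable:
  fixes A P :: "real^'n^'n" and \<phi> \<phi>' :: "real \<Rightarrow> real^'n"
  assumes l: "l \<noteq> 0"
    and AP: "A ** P = l *\<^sub>R P" and PA: "P ** A = l *\<^sub>R P"
    and P_bound: "\<And>x. infnorm (P *v x) \<le> m * infnorm x" and m: "m \<ge> 0"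
    and der: "\<And>t. (\<phi> has_vector_derivative \<phi>' t) (at t)"
    and bound: "\<And>t. infnorm (\<phi>' t - A *v \<phi> t) \<le> \<epsilon>"
  shows "\<exists>w. A *v w = l *\<^sub>R w \<and> (\<forall>t. infnorm (P *v \<phi> t - exp (l * t) *\<^sub>R w) \<le> m * \<epsilon> / \<bar>l\<bar>)"
proof -
  have defect: "P *v \<phi>' t - l *\<^sub>R (P *v \<phi> t) = P *v (\<phi>' t - A *v \<phi> t)" for t
    by (simp add: matrix_vector_mult_diff_distrib matrix_vector_mul_assoc PA
        scaleR_matrix_vector_assoc)
  have "infnorm (P *v \<phi>' t - l *\<^sub>R (P *v \<phi> t)) \<le> m * \<epsilon>" for t
    unfolding defect using P_bound bound m by (meson mult_left_mono order_trans)
  then have comp_bound: "\<bar>(P *v \<phi>' t) $ i - l * (P *v \<phi> t) $ i\<bar> \<le> m * \<epsilon>" for t i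
    unfolding infnorm_le_iff_cart by simp
  have "((\<lambda>t. P *v \<phi> t) has_vector_derivative P *v \<phi>' t) (at t)" for t
    using bounded_linear.has_vector_derivative[OF matrix_vector_mul_bounded_linear der] .
  then have comp_der: "((\<lambda>t. (P *v \<phi> t) $ i) has_real_derivative (P *v \<phi>' t) $ i) (at t)" for t i
    using bounded_linear.has_vector_derivative[OF bounded_linear_vec_nth]
    by (fastforce simp: has_real_derivative_iff_has_vector_derivative)
  have "\<forall>i. \<exists>C. \<forall>t. \<bar>(P *v \<phi> t) $ i - exp (l * t) * C\<bar> \<le> m * \<epsilon> / \<bar>l\<bar>"
    using scalar_hyers_ulam[OF l comp_der comp_bound] by blast
  then obtain C where C: "\<And>i t. \<bar>(P *v \<phi> t) $ i - exp (l * t) * C i\<bar> \<le> m * \<epsilon> / \<bar>l\<bar>"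
    by metis
  define w where "w = (\<chi> i. C i)"
  define r where "r t = P *v \<phi> t - exp (l * t) *\<^sub>R w" for t
  have r_bound: "infnorm (r t) \<le> m * \<epsilon> / \<bar>l\<bar>" for t
    unfolding infnorm_le_iff_cart r_def w_def using C by simp
  define z where "z = l *\<^sub>R w - A *v w"
  have "z = 0"
  proof (rule ccontr)
    assume "z \<noteq> 0"
    have Ar: "A *v r t - l *\<^sub>R r t = exp (l * t) *\<^sub>R z" for t
      by (simp add: r_def z_def matrix_vector_mult_diff_distrib matrix_vector_mul_assoc AP
          matrix_vector_mult_scaleR scaleR_matrix_vector_assoc scaleR_diff_right mult.commute)
    have "bounded_linear (\<lambda>x. A *v x - l *\<^sub>R x)"
      by (intro bounded_linear_sub matrix_vector_mul_bounded_linear bounded_linear_scaleR_right)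
    then obtain B where B: "B > 0" "\<And>x. norm (A *v x - l *\<^sub>R x) \<le> norm x * B"
      using bounded_linear.pos_bounded by blast
    define N where "N = sqrt DIM(real^'n) * (m * \<epsilon> / \<bar>l\<bar>) * B"
    have "norm (r t) \<le> sqrt DIM(real^'n) * (m * \<epsilon> / \<bar>l\<bar>)" for t
      using norm_le_infnorm[of "r t"] r_bound[of t]
      by (meson mult_left_mono order_trans real_sqrt_ge_zero of_nat_0_le_iff)
    then have "norm (r t) * B \<le> N" for t
      unfolding N_def using B(1) by (meson less_imp_le mult_right_mono)
    then have N: "exp (l * t) * norm z \<le> N" for t
      using B(2)[of "r t"] unfolding Ar by (simp add: order_trans)
    \<comment> \<open>At the time \<open>N / norm z / l\<close> the exponent is \<open>N / norm z\<close>, and \<open>exp s > s\<close> gives a value above \<open>N\<close>.\<close>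
    have "exp (N / norm z) * norm z \<le> N"
      using N[of "N / norm z / l"] l by simp
    then have "exp (N / norm z) \<le> N / norm z"
      using \<open>z \<noteq> 0\<close> by (simp add: pos_le_divide_eq)
    then show False
      using exp_ge_add_one_self[of "N / norm z"] by linarith
  qed
  then have "A *v w = l *\<^sub>R w" by (simp add: z_def)
  with r_bound show ?thesis unfolding r_def by blast
qed

section \<open>Two-dimensional systems\<close>

lemma eigenvalue_characteristic_2:
  fixes A :: "real^2^2"
  assumes "eigenvalue A l"
  shows "(A $ 1 $ 1 - l) * (A $ 2 $ 2 - l) = A $ 1 $ 2 * A $ 2 $ 1"
proof -
  obtain v where v: "v \<noteq> 0" "A *v v = l *\<^sub>R v"
    using assms unfolding eigenvalue_def by blast
  then have "(A - mat l) *v v = 0"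
    by (simp add: vec_eq_iff forall_2 matrix_vector_mult_def sum_2 mat_def algebra_simps)
  with v(1) have "det (A - mat l) = 0"
    by (metis invertible_det_nz invertible_left_inverse matrix_left_invertible_ker)
  then show ?thesis by (simp add: det_2 mat_def)
qed

lemma infnorm_matrix_vector_mult_2:
  fixes x :: "real^2"
  shows "infnorm ((vector [vector [p, q], vector [r, s]] :: real^2^2) *v x)
    \<le> max (\<bar>p\<bar> + \<bar>q\<bar>) (\<bar>r\<bar> + \<bar>s\<bar>) * infnorm x"
proof -
  have row: "\<bar>y * x $ 1 + z * x $ 2\<bar> \<le> (\<bar>y\<bar> + \<bar>z\<bar>) * infnorm x" for y z
  proof -
    have "\<bar>y * x $ 1 + z * x $ 2\<bar> \<le> \<bar>y\<bar> * \<bar>x $ 1\<bar> + \<bar>z\<bar> * \<bar>x $ 2\<bar>"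
      by (metis abs_mult abs_triangle_ineq)
    also have "\<dots> \<le> \<bar>y\<bar> * infnorm x + \<bar>z\<bar> * infnorm x"
      by (intro add_mono mult_left_mono component_le_infnorm_cart) auto
    finally show ?thesis by (simp add: algebra_simps)
  qed
  have "\<bar>y * x $ 1 + z * x $ 2\<bar> \<le> M * infnorm x" if "\<bar>y\<bar> + \<bar>z\<bar> \<le> M" for y z M
    using row[of y z] mult_right_mono[OF that infnorm_pos_le[of x]] by linarith
  then show ?thesis
    unfolding infnorm_le_iff_cart forall_2 by (simp add: matrix_vector_mult_def sum_2)
qed

lemma solves_system_eigenvector:
  assumes "A *v w = l *\<^sub>R w"
  shows "solves_system A (\<lambda>t. exp (l * t) *\<^sub>R w)"
  unfolding solves_system_def
  by (auto intro!: derivative_eq_intros simp: matrix_vector_mult_scaleR assms mult.commute)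

lemma solves_system_add:
  assumes "solves_system A x" "solves_system A y"
  shows "solves_system A (\<lambda>t. x t + y t)"
  using assms unfolding solves_system_def
  by (auto intro: has_vector_derivative_add simp: matrix_vector_right_distrib)

theorem theorem3p2:
  fixes A :: "real^2^2" and l1 l2 :: real
  assumes "eigenvalue A l1" and "eigenvalue A l2"
    and "l1 \<noteq> 0" and "l2 \<noteq> 0" and "l1 > l2"
  shows "\<exists>a b c :: real.
    A = vector [vector [a, b], vector [c, l1 + l2 - a]] \<and>
    hyers_ulam_stable_with_constant A
      ((\<bar>l2\<bar> * max (\<bar>a - l2\<bar> + \<bar>b\<bar>) (\<bar>c\<bar> + \<bar>l1 - a\<bar>) +
        \<bar>l1\<bar> * max (\<bar>l1 - a\<bar> + \<bar>b\<bar>) (\<bar>c\<bar> + \<bar>a - l2\<bar>)) /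
       (\<bar>l1 * l2\<bar> * (l1 - l2)))"
proof -
  define a b c where "a = A $ 1 $ 1" and "b = A $ 1 $ 2" and "c = A $ 2 $ 1"
  define d where "d = l1 - l2"
  have d: "d > 0" using assms(5) by (simp add: d_def)
  have char: "(a - l1) * (A $ 2 $ 2 - l1) = b * c" "(a - l2) * (A $ 2 $ 2 - l2) = b * c"
    using assms(1,2)[THEN eigenvalue_characteristic_2] by (simp_all add: a_def b_def c_def)
  then have "(l1 - l2) * (a + A $ 2 $ 2 - l1 - l2) = 0"
    by (simp add: algebra_simps)
  then have trace: "A $ 2 $ 2 = l1 + l2 - a" using assms(5) by simp
  have A_eq: "A = vector [vector [a, b], vector [c, l1 + l2 - a]]"
    by (simp add: vec_eq_iff forall_2 trace flip: a_def b_def c_def)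
  have bc: "b * c = (a - l1) * (l2 - a)"
    using char(1) trace by simp
  define M1 where "M1 = max (\<bar>a - l2\<bar> + \<bar>b\<bar>) (\<bar>c\<bar> + \<bar>l1 - a\<bar>)"
  define M2 where "M2 = max (\<bar>l1 - a\<bar> + \<bar>b\<bar>) (\<bar>c\<bar> + \<bar>a - l2\<bar>)"
  define P :: "real^2^2" where
    "P = vector [vector [(a - l2) / d, b / d], vector [c / d, (l1 - a) / d]]"
  define Q :: "real^2^2" where
    "Q = vector [vector [(l1 - a) / d, - b / d], vector [- c / d, (a - l2) / d]]"
  have PQ: "P + Q = mat 1"
    using d by (simp add: vec_eq_iff forall_2 P_def Q_def mat_def d_def flip: add_divide_distrib)
  have P_A: "P = (1 / d) *\<^sub>R (A - mat l2)" and Q_A: "Q = (1 / d) *\<^sub>R (mat l1 - A)"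
    by (simp_all add: vec_eq_iff forall_2 P_def Q_def A_eq mat_def)
  have "A ** (A - mat l2) = l1 *\<^sub>R (A - mat l2)" "(A - mat l2) ** A = l1 *\<^sub>R (A - mat l2)"
    using bc by (simp_all add: vec_eq_iff forall_2 A_eq matrix_matrix_mult_def sum_2 mat_def
        algebra_simps)
  then have P_eigen: "A ** P = l1 *\<^sub>R P" "P ** A = l1 *\<^sub>R P"
    unfolding P_A by (simp_all add: matrix_scalar_ac flip: scalar_matrix_assoc)
  have "A ** (mat l1 - A) = l2 *\<^sub>R (mat l1 - A)" "(mat l1 - A) ** A = l2 *\<^sub>R (mat l1 - A)"
    using bc by (simp_all add: vec_eq_iff forall_2 A_eq matrix_matrix_mult_def sum_2 mat_def
        algebra_simps)
  then have Q_eigen: "A ** Q = l2 *\<^sub>R Q" "Q ** A = l2 *\<^sub>R Q"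
    unfolding Q_A by (simp_all add: matrix_scalar_ac flip: scalar_matrix_assoc)
  have max_d: "max (p / d) (q / d) = max p q / d" for p q
    using d by (simp add: max_def divide_le_cancel)
  have P_bound: "infnorm (P *v x) \<le> M1 / d * infnorm x" for x
    using infnorm_matrix_vector_mult_2[of "(a - l2) / d" "b / d" "c / d" "(l1 - a) / d" x] d
    by (simp add: P_def M1_def max_d flip: add_divide_distrib)
  have Q_bound: "infnorm (Q *v x) \<le> M2 / d * infnorm x" for x
    using infnorm_matrix_vector_mult_2[of "(l1 - a) / d" "- b / d" "- c / d" "(a - l2) / d" x] d
    by (simp add: Q_def M2_def max_d flip: add_divide_distrib)
  \<comment> \<open>Both maxima are positive, as \<open>a - l2\<close> and \<open>l1 - a\<close> cannot vanish together.\<close>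
  have M_pos: "M1 > 0" "M2 > 0"
    using assms(5) unfolding M1_def M2_def by auto
  then have M_nonneg: "M1 / d \<ge> 0" "M2 / d \<ge> 0"
    using d by simp_all
  define K where "K = (\<bar>l2\<bar> * M1 + \<bar>l1\<bar> * M2) / (\<bar>l1 * l2\<bar> * (l1 - l2))"
  have K_eq: "K * \<epsilon> = M1 / d * \<epsilon> / \<bar>l1\<bar> + M2 / d * \<epsilon> / \<bar>l2\<bar>" for \<epsilon>
    using assms(3,4) d unfolding K_def d_def[symmetric] by (simp add: abs_mult field_simps)
  have "K > 0"
    unfolding K_def using M_pos assms(3-5)
    by (intro divide_pos_pos add_pos_pos mult_pos_pos) auto
  moreover have "\<exists>x. solves_system A x \<and> (\<forall>t. infnorm (\<phi> t - x t) \<le> K * \<epsilon>)"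
    if diff: "\<forall>t. \<phi> differentiable (at t)"
      and bound: "\<forall>t. infnorm (vector_derivative \<phi> (at t) - A *v \<phi> t) \<le> \<epsilon>" for \<epsilon> \<phi>
  proof -
    have der: "(\<phi> has_vector_derivative vector_derivative \<phi> (at t)) (at t)" for t
      using diff by (simp add: vector_derivative_works)
    obtain v where v: "A *v v = l1 *\<^sub>R v"
      "\<And>t. infnorm (P *v \<phi> t - exp (l1 * t) *\<^sub>R v) \<le> M1 / d * \<epsilon> / \<bar>l1\<bar>"
      using spectral_component_stable[OF assms(3) P_eigen P_bound M_nonneg(1) der bound[rule_format]]
      by blast
    obtain w where w: "A *v w = l2 *\<^sub>R w"
      "\<And>t. infnorm (Q *v \<phi> t - exp (l2 * t) *\<^sub>R w) \<le> M2 / d * \<epsilon> / \<bar>l2\<bar>"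
      using spectral_component_stable[OF assms(4) Q_eigen Q_bound M_nonneg(2) der bound[rule_format]]
      by blast
    define x where "x t = exp (l1 * t) *\<^sub>R v + exp (l2 * t) *\<^sub>R w" for t
    have "solves_system A x"
      unfolding x_def by (intro solves_system_add solves_system_eigenvector v(1) w(1))
    moreover have "infnorm (\<phi> t - x t) \<le> K * \<epsilon>" for t
    proof -
      have "\<phi> t = P *v \<phi> t + Q *v \<phi> t"
        by (simp add: PQ flip: matrix_vector_mult_add_rdistrib)
      then have "\<phi> t - x t = (P *v \<phi> t - exp (l1 * t) *\<^sub>R v) + (Q *v \<phi> t - exp (l2 * t) *\<^sub>R w)"
        unfolding x_def by simp
      then have "infnorm (\<phi> t - x t) \<le>
          infnorm (P *v \<phi> t - exp (l1 * t) *\<^sub>R v) + infnorm (Q *v \<phi> t - exp (l2 * t) *\<^sub>R w)"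
        by (simp only: infnorm_triangle)
      then show ?thesis
        using v(2)[of t] w(2)[of t] unfolding K_eq by linarith
    qed
    ultimately show ?thesis by blast
  qed
  ultimately have "hyers_ulam_stable_with_constant A K"
    unfolding hyers_ulam_stable_with_constant_def by blast
  then show ?thesis
    unfolding K_def M1_def M2_def using A_eq by blast
qed

end
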